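(* Let $\mathbb{R}_+$ denote the positive reals and define $$\mathfrak{R}_1=\{(a,b,c)\in\mathbb{R}_+^3:\ c\ge a+b-1,\ (1+a+b-ab)c\ge 2ab,\ (c-a)(c-b)\ge0\},$$ $$\mathfrak{R}_2=\{(a,b,c)\in\mathbb{R}_+^3:\ c\ge a+b-1,\ (c-a)(c-b)\le0\}.$$ Let $p\in\mathbb{R}$, let $\mathcal{F}_p(x)=(1-x)^pF(a,b;c;x)$ for $x\in(0,1)$, and let $C_n$ ($n\ge1$) be the Maclaurin coefficients of $\ln F(a,b;c;x)$, i.e. $\ln F(a,b;c;x)=\sum_{n=1}^\infty C_nx^n$. (i) If $(a,b,c)\in\mathfrak{R}_1$, then: - $\ln\mathcal{F}_p$ is absolutely monotonic on $(0,1)$ if and only if $p\le\max\{0,a+b-c\}$; - $-\ln\mathcal{F}_p$ is absolutely monotonic on $(0,1)$ if and only if $p\ge\frac{ab}{c}$; - for every integer $k\ge1$, $(\ln\mathcal{F}_p)^{(k)}$ is absolutely monotonic on $(0,1)$ if and only if $p\le\max\{0,a+b-c\}$, and $-(\ln\mathcal{F}_p)^{(k)}$ is absolutely monotonic on $(0,1)$ if and only if $p\ge kC_k$. (ii) If $(a,b,c)\in\mathfrak{R}_2$, then: - $\ln\mathcal{F}_p$ is absolutely monotonic on $(0,1)$ if and only if $p\le\frac{ab}{c}$; - $-\ln\mathcal{F}_p$ is absolutely monotonic on $(0,1)$ if and only if $p\ge a+b-c$; - for every integer $k\ge1$, $(\ln\mathcal{F}_p)^{(k)}$ is absolutely monotonic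 on $(0,1)$ if and only if $p\le kC_k$, and $-(\ln\mathcal{F}_p)^{(k)}$ is absolutely monotonic on $(0,1)$ if and only if $p\ge a+b-c$.
   Context: $F(a,b;c;x)=\sum_{n=0}^\infty\frac{(a)_n(b)_n}{(c)_n}\frac{x^n}{n!}$ is the Gaussian hypergeometric function, with $(a)_0=1$ and $(a)_n=a(a+1)\cdots(a+n-1)$ for $n\ge1$. A function $f$ is absolutely monotonic on an interval $I$ if all derivatives $f^{(k)}$ exist on $I$ and $f^{(k)}(x)\ge0$ for all $x\in I$ and all integers $k\ge0$. The superscript $(k)$ denotes the $k$-th derivative. *)

theory Defs
  imports "HOL-Analysis.Analysis"
begin

definition gauss_hyp :: "real \<Rightarrow> real \<Rightarrow> real \<Rightarrow> real \<Rightarrow> real" where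
  "gauss_hyp a b c x =
     (\<Sum>n. pochhammer a n * pochhammer b n / pochhammer c n * (x ^ n / fact n))"

(* Derivatives are two-sided, so this is only meant for open I. *)
definition abs_monotonic_on :: "(real \<Rightarrow> real) \<Rightarrow> real set \<Rightarrow> bool" where
  "abs_monotonic_on f I \<longleftrightarrow>
     (\<forall>k. \<forall>x\<in>I. ((deriv ^^ k) f) differentiable (at x) \<and> 0 \<le> (deriv ^^ k) f x)"

definition maclaurin_coeff :: "(real \<Rightarrow> real) \<Rightarrow> nat \<Rightarrow> real" where
  "maclaurin_coeff f n = (deriv ^^ n) f 0 / fact n"

(* The values maclaurin_coeff f n are the coefficients of any convergent power
   series representing f near 0. *)
lemma maclaurin_coeff_eq_fps_nth:
  assumes "f has_fps_expansion C"
  shows "maclaurin_coeff f n = fps_nth C n"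
proof -
  have "(deriv ^^ n) f 0 = fact n * fps_nth C n"
    using assms
  proof (induction n arbitrary: f C)
    case 0
    then show ?case by (auto simp: has_fps_expansion_def eval_fps_at_0 dest: eventually_nhds_x_imp_x)
  next
    case (Suc n)
    have "(deriv ^^ n) (deriv f) 0 = fact n * fps_nth (fps_deriv C) n"
      using Suc.IH has_fps_expansion_deriv[OF Suc.prems] by blast
    then show ?case
      by (simp add: funpow_Suc_right algebra_simps del: funpow.simps)
  qed
  then show ?thesis
    by (simp add: maclaurin_coeff_def)
qed

definition \<F> :: "real \<Rightarrow> real \<Rightarrow> real \<Rightarrow> real \<Rightarrow> real \<Rightarrow> real" where
  "\<F> a b c p x = (1 - x) powr p * gauss_hyp a b c x"

definition log_hyp_coeff :: "real \<Rightarrow> real \<Rightarrow> real \<Rightarrow> nat \<Rightarrow> real" where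
  "log_hyp_coeff a b c = maclaurin_coeff (\<lambda>x. ln (gauss_hyp a b c x))"

definition \<RR>\<^sub>1 :: "(real \<times> real \<times> real) set" where
  "\<RR>\<^sub>1 = {(a, b, c). 0 < a \<and> 0 < b \<and> 0 < c \<and>
     c \<ge> a + b - 1 \<and> (1 + a + b - a * b) * c \<ge> 2 * a * b \<and> (c - a) * (c - b) \<ge> 0}"

definition \<RR>\<^sub>2 :: "(real \<times> real \<times> real) set" where
  "\<RR>\<^sub>2 = {(a, b, c). 0 < a \<and> 0 < b \<and> 0 < c \<and>
     c \<ge> a + b - 1 \<and> (c - a) * (c - b) \<le> 0}"

end

theory Submission
  imports Defs "HOL-Real_Asymp.Real_Asymp"
begin

text \<open>
  Write \<open>F = F(a,b;c;x) = \<Sum> A\<^sub>n x\<^sup>n\<close> and \<open>F'/F = \<Sum> d\<^sub>n x\<^sup>n\<close>. The Maclaurin coefficients of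
  \<open>ln F\<close> are \<open>C\<^sub>n = d\<^sub>n\<^sub>-\<^sub>1 / n\<close>, and those of \<open>ln \<F>\<^sub>p\<close> are \<open>(d\<^sub>n\<^sub>-\<^sub>1 - p) / n\<close>. A power
  series that converges on \<open>(-1,1)\<close> is absolutely monotonic on \<open>(0,1)\<close> exactly when its
  coefficients are nonnegative, so every equivalence in the theorem compares \<open>p\<close> with all
  \<open>d\<^sub>n\<close> for \<open>n \<ge> k - 1\<close> (lemma \<open>abs_monotonic_iff\<close>). It remains to show that \<open>d\<^sub>n\<close> is monotone, so that one
  bound is \<open>d\<^sub>k\<^sub>-\<^sub>1\<close> (or \<open>d\<^sub>0 = ab/c\<close> for \<open>k = 0\<close>), and to find the limit, which is the other bound.

  Monotonicity is a sign statement about \<open>h = (1 - x) F'/F\<close>, whose coefficients are the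
  differences of the \<open>d\<^sub>n\<close>. Comparing coefficients in \<open>h F = (1 - x) F'\<close> gives
  \<open>\<Sum>\<^sub>k h\<^sub>k A\<^sub>n\<^sub>-\<^sub>k = \<psi>\<^sub>n A\<^sub>n\<close> with \<open>\<psi>\<^sub>n = a + b - c + (c - a)(c - b) / (c + n)\<close>. Here \<open>\<psi>\<close> is
  monotone, in a direction given by the sign of \<open>(c - a)(c - b)\<close>, and in both regions
  the sequence \<open>A\<^sub>n\<close> is log-convex. An argument in the style of Kaluza (lemma \<open>kaluza_sign\<close>)
  then shows that all \<open>h\<^sub>n\<close> with \<open>n \<ge> 1\<close> have the sign of the increments of \<open>\<psi>\<close>.

  For the limit, \<open>A\<^sub>n\<close> decreases, so the convolution identity compares the partial sum
  \<open>d\<^sub>n = \<Sum>\<^sub>k h\<^sub>k\<close> with \<open>\<psi>\<^sub>n\<close>; hence \<open>d\<^sub>n \<ge> a + b - c\<close> when \<open>d\<close> decreases and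
  \<open>d\<^sub>n \<le> a + b - c\<close> when it increases. The Kaluza argument for \<open>F' = (F'/F) F\<close> also gives
  \<open>d\<^sub>n \<ge> 0\<close>. These bounds are sharp: if all \<open>d\<^sub>n\<close> exceed some positive
  number, then \<open>A\<^sub>n\<close> is at least a multiple of \<open>1/n\<close>, so \<open>\<Sum> A\<^sub>n\<close> diverges, and the averages of
  \<open>\<psi>\<close> with weights \<open>A\<^sub>n\<close> tend to \<open>a + b - c\<close>. Since
  \<open>\<Sum>\<^sub>k\<^sub>\<le>\<^sub>n d\<^sub>k A\<^sub>n\<^sub>-\<^sub>k = \<Sum>\<^sub>k\<^sub>\<le>\<^sub>n \<psi>\<^sub>k A\<^sub>k\<close>, no positive lower bound of the \<open>d\<^sub>n\<close> exceeds
  \<open>a + b - c\<close>, and no upper bound is smaller than \<open>a + b - c\<close> if they also have a positive lower bound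
  (lemmas \<open>le_excess_limit\<close> and \<open>excess_limit_le\<close>).
\<close>

section \<open>Convolutions with a log-convex sequence\<close>

text \<open>
  Subtracting \<open>A\<^sub>m\<^sub>+\<^sub>1 / A\<^sub>m\<close> times the identity for \<open>m\<close> from the one for \<open>m + 1\<close> leaves
  \<open>u\<^sub>m\<^sub>+\<^sub>1 A\<^sub>0 = (w\<^sub>m\<^sub>+\<^sub>1 - w\<^sub>m) A\<^sub>m\<^sub>+\<^sub>1 + \<Sum>\<^sub>k u\<^sub>k A\<^sub>m\<^sub>-\<^sub>k (r\<^sub>m - r\<^sub>m\<^sub>-\<^sub>k)\<close> with the ratios
  \<open>r\<^sub>n = A\<^sub>n\<^sub>+\<^sub>1 / A\<^sub>n\<close>. The term \<open>k = 0\<close> vanishes, and the others are nonnegative by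
  induction.
\<close>

lemma kaluza_sign:
  fixes A u w :: "nat \<Rightarrow> real"
  assumes pos: "\<And>n. A n > 0"
    and log_convex: "mono (\<lambda>n. A (Suc n) / A n)"
    and conv: "\<And>n. (\<Sum>k\<le>n. u k * A (n - k)) = w n * A n"
    and mono: "mono w"
  shows "n \<ge> 1 \<Longrightarrow> u n \<ge> 0"
proof (induction n rule: less_induct)
  case (less n)
  then obtain m where n: "n = Suc m" by (cases n) auto
  define r where "r n = A (Suc n) / A n" for n
  have A_Suc: "A (Suc k) = r k * A k" for k
    using pos[of k] by (simp add: r_def)
  have "u n * A 0 = w (Suc m) * A (Suc m) - (\<Sum>k\<le>m. u k * A (Suc m - k))"
    using conv[of "Suc m"] by (simp add: n)
  also have "(\<Sum>k\<le>m. u k * A (Suc m - k)) = (\<Sum>k\<le>m. u k * A (m - k) * r (m - k))"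
    by (intro sum.cong) (auto simp: Suc_diff_le A_Suc)
  also have "w (Suc m) * A (Suc m) = (w (Suc m) - w m) * A (Suc m) + w m * A m * r m"
    by (simp add: A_Suc algebra_simps)
  also have "w m * A m * r m = (\<Sum>k\<le>m. u k * A (m - k) * r m)"
    by (simp add: sum_distrib_right[symmetric] conv)
  finally have "u n * A 0 = (w (Suc m) - w m) * A (Suc m)
      + (\<Sum>k\<le>m. u k * A (m - k) * (r m - r (m - k)))"
    by (simp add: sum_subtractf algebra_simps)
  moreover have "(w (Suc m) - w m) * A (Suc m) \<ge> 0"
    using monoD[OF mono, of m "Suc m"] pos[of "Suc m"] by simp
  moreover have "(\<Sum>k\<le>m. u k * A (m - k) * (r m - r (m - k))) \<ge> 0"
  proof (rule sum_nonneg)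
    fix k assume k: "k \<in> {..m}"
    show "u k * A (m - k) * (r m - r (m - k)) \<ge> 0"
    proof (cases "k = 0")
      case False
      then have "u k \<ge> 0" using less.IH[of k] k n by simp
      moreover have "r (m - k) \<le> r m"
        using monoD[OF log_convex, of "m - k" m] by (simp add: r_def)
      ultimately show ?thesis using pos[of "m - k"] by simp
    qed simp
  qed
  ultimately have "u n * A 0 \<ge> 0" by linarith
  then show ?case using pos[of 0] by (simp add: zero_le_mult_iff)
qed

text \<open>
  Replacing each \<open>A\<^sub>n\<^sub>-\<^sub>k\<close> by the smaller \<open>A\<^sub>n\<close> changes nothing in the term \<open>k = 0\<close> and
  decreases the others.
\<close>

lemma convolution_ge_partial_sum:
  fixes A u :: "nat \<Rightarrow> real" and w :: real
  assumes pos: "\<And>n. A n > 0" and decr: "decseq A"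
    and conv: "(\<Sum>k\<le>n. u k * A (n - k)) = w * A n"
    and nonneg: "\<And>k. k \<ge> 1 \<Longrightarrow> u k \<ge> 0"
  shows "(\<Sum>k\<le>n. u k) \<le> w"
proof -
  have "(\<Sum>k\<le>n. u k) * A n \<le> (\<Sum>k\<le>n. u k * A (n - k))"
    unfolding sum_distrib_right
  proof (rule sum_mono)
    fix k
    show "u k * A n \<le> u k * A (n - k)"
      using nonneg[of k] decseqD[OF decr, of "n - k" n]
      by (cases "k = 0") (auto intro: mult_left_mono)
  qed
  then show ?thesis using conv pos[of n] by simp
qed

text \<open>
  If \<open>l < t\<close>, then all but finitely many of the numbers \<open>w\<^sub>k - t\<close> lie below a fixed negative
  number, and nonnegative sums \<open>\<Sum>\<^sub>k (w\<^sub>k - t) A\<^sub>k\<close> would bound the partial sums of \<open>A\<close>.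
\<close>

lemma weighted_average_limit_le:
  fixes A w :: "nat \<Rightarrow> real"
  assumes nonneg: "\<And>n. A n \<ge> 0" and diverges: "\<not> summable A"
    and lim: "w \<longlonglongrightarrow> l"
    and avg: "\<And>n. (\<Sum>k\<le>n. (w k - t) * A k) \<ge> 0"
  shows "t \<le> l"
proof (rule ccontr)
  assume "\<not> t \<le> l"
  define e where "e = (t - l) / 2"
  have e: "e > 0" using \<open>\<not> t \<le> l\<close> by (simp add: e_def)
  have "eventually (\<lambda>k. w k < l + e) sequentially"
    using lim e by (intro order_tendstoD) auto
  then obtain N where N: "\<And>k. k \<ge> N \<Longrightarrow> w k < l + e"
    by (auto simp: eventually_sequentially)
  \<comment> \<open>The terms with \<open>k < N\<close>, where nothing is known about \<open>w\<^sub>k\<close>, are absorbed in a constant.\<close>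
  define B where "B = (\<Sum>k<N. \<bar>w k - t\<bar> * A k + e * A k)"
  have "sum A {..n} \<le> B / e" for n
  proof -
    have "0 \<le> (\<Sum>k\<le>n. (w k - t) * A k)" by (rule avg)
    also have "\<dots> \<le> (\<Sum>k\<le>n. (if k < N then \<bar>w k - t\<bar> * A k + e * A k else 0) - e * A k)"
    proof (rule sum_mono)
      fix k
      show "(w k - t) * A k \<le> (if k < N then \<bar>w k - t\<bar> * A k + e * A k else 0) - e * A k"
      proof (cases "k < N")
        case True
        then show ?thesis using nonneg[of k] by (simp add: mult_right_mono)
      next
        case False
        then have "w k - t \<le> - e" using N[of k] by (simp add: e_def field_simps)
        then have "(w k - t) * A k \<le> - e * A k" using nonneg[of k] by (rule mult_right_mono)
        then show ?thesis using False by simp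
      qed
    qed
    also have "\<dots> = (\<Sum>k\<le>n. (if k < N then \<bar>w k - t\<bar> * A k + e * A k else 0)) - e * sum A {..n}"
      by (simp add: sum_subtractf sum_distrib_left)
    also have "(\<Sum>k\<le>n. (if k < N then \<bar>w k - t\<bar> * A k + e * A k else 0)) \<le> B"
    proof -
      have "(\<Sum>k\<le>n. (if k < N then \<bar>w k - t\<bar> * A k + e * A k else 0))
          = (\<Sum>k\<in>{..n} \<inter> {k. k < N}. \<bar>w k - t\<bar> * A k + e * A k)"
        by (simp add: sum.If_cases)
      also have "\<dots> \<le> B" unfolding B_def
        by (rule sum_mono2) (use nonneg e in auto)
      finally show ?thesis .
    qed
    finally show ?thesis using e by (simp add: field_simps)
  qed
  then have "summable A"
    using nonneg bounded_imp_summable by blast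
  with diverges show False by simp
qed

section \<open>Power series and absolute monotonicity\<close>

lemma bounded_coeffs_conv_radius:
  fixes f :: "real fps"
  assumes "\<And>n. \<bar>fps_nth f n\<bar> \<le> B"
  shows "fps_conv_radius f \<ge> 1"
  unfolding fps_conv_radius_def
proof (rule conv_radius_geI_ex')
  fix r :: real assume r: "0 < r" "ereal r < 1"
  then have r1: "r < 1" by (simp add: one_ereal_def)
  show "summable (\<lambda>n. fps_nth f n * of_real r ^ n)"
  proof (rule summable_comparison_test')
    show "summable (\<lambda>n. B * r ^ n)"
      using r r1 by (intro summable_mult summable_geometric) simp
    show "norm (fps_nth f n * of_real r ^ n) \<le> B * r ^ n" for n
      using assms[of n] r by (simp add: abs_mult mult_right_mono)
  qed
qed

lemma norm_less_conv_radius: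
  fixes f :: "real fps" and x :: real
  assumes "fps_conv_radius f \<ge> 1" "\<bar>x\<bar> < 1"
  shows "ereal (norm x) < fps_conv_radius f"
proof -
  have "ereal (norm x) < 1" using assms(2) by (simp add: one_ereal_def)
  then show ?thesis using assms(1) by (rule less_le_trans)
qed

lemma fps_nth_nth_deriv:
  "fps_nth (fps_nth_deriv k (f :: real fps)) n = pochhammer (of_nat n + 1) k * fps_nth f (n + k)"
proof (induction k arbitrary: f)
  case (Suc k)
  show ?case
    by (simp add: Suc pochhammer_rec' algebra_simps)
qed simp

lemma conv_radius_nth_deriv:
  fixes f :: "real fps"
  assumes "fps_conv_radius f \<ge> 1"
  shows "fps_conv_radius (fps_nth_deriv k f) \<ge> 1"
  using assms
proof (induction k arbitrary: f)
  case (Suc k)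
  then show ?case using order_trans[OF Suc.prems fps_conv_radius_deriv] by simp
qed simp

lemma higher_deriv_power_series:
  fixes f :: "real fps"
  assumes "fps_conv_radius f \<ge> 1"
    and "\<And>x. \<bar>x\<bar> < 1 \<Longrightarrow> g x = eval_fps f x"
    and "\<bar>x\<bar> < 1"
  shows "(deriv ^^ k) g x = eval_fps (fps_nth_deriv k f) x"
  using assms
proof (induction k arbitrary: f g)
  case (Suc k)
  have "deriv g y = eval_fps (fps_deriv f) y" if y: "\<bar>y\<bar> < 1" for y
  proof -
    have "eventually (\<lambda>z. z \<in> {-1<..<1}) (nhds y)"
      using y by (intro eventually_nhds_in_open) auto
    then have "eventually (\<lambda>z. g z = eval_fps f z) (nhds y)"
      by (rule eventually_mono) (use Suc.prems in auto)
    then have "deriv g y = deriv (eval_fps f) y"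
      by (rule deriv_cong_ev) simp
    also have "\<dots> = eval_fps (fps_deriv f) y"
      by (intro DERIV_imp_deriv has_field_derivative_eval_fps
            norm_less_conv_radius Suc.prems y)
    finally show ?thesis .
  qed
  moreover have "fps_conv_radius (fps_deriv f) \<ge> 1"
    using order_trans[OF Suc.prems(1) fps_conv_radius_deriv] .
  ultimately show ?case
    using Suc.IH[of "fps_deriv f" "deriv g"] Suc.prems(3)
    by (simp add: funpow_Suc_right del: funpow.simps)
qed simp

text \<open>
  The coefficient of index \<open>n\<close> is, up to \<open>n!\<close>, the limit at \<open>0\<close> of the \<open>n\<close>-th derivative.
  Conversely all derivatives again have nonnegative coefficients.
\<close>

lemma abs_monotonic_on_power_series_iff:
  fixes f :: "real fps"
  assumes conv: "fps_conv_radius f \<ge> 1"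
    and eq: "\<And>x. \<bar>x\<bar> < 1 \<Longrightarrow> g x = eval_fps f x"
  shows "abs_monotonic_on g {0<..<1} \<longleftrightarrow> (\<forall>n. fps_nth f n \<ge> 0)"
proof
  note derivs = higher_deriv_power_series[OF conv eq]
  note less_radius = norm_less_conv_radius[OF conv_radius_nth_deriv[OF conv]]
  {
    assume am: "abs_monotonic_on g {0<..<1}"
    show "\<forall>n. fps_nth f n \<ge> 0"
    proof
      fix n
      let ?f = "fps_nth_deriv n f"
      have "continuous (at_right 0) (eval_fps ?f)"
        by (rule continuous_at_imp_continuous_at_within, rule DERIV_isCont,
            rule has_field_derivative_eval_fps, rule less_radius) simp
      then have "(eval_fps ?f \<longlongrightarrow> eval_fps ?f 0) (at_right 0)"
        by (simp add: continuous_within)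
      moreover have "eventually (\<lambda>x. eval_fps ?f x \<ge> 0) (at_right 0)"
      proof -
        have "eventually (\<lambda>x::real. x \<in> {0<..<1}) (at_right 0)"
          by (rule eventually_at_right_real) simp
        then show ?thesis
        proof (rule eventually_mono)
          fix x :: real assume x: "x \<in> {0<..<1}"
          then have "(deriv ^^ n) g x \<ge> 0" using am by (auto simp: abs_monotonic_on_def)
          then show "eval_fps ?f x \<ge> 0" using x derivs[of x n] by simp
        qed
      qed
      ultimately have "eval_fps ?f 0 \<ge> 0"
        by (rule tendsto_lowerbound) simp
      then have "fact n * fps_nth f n \<ge> 0"
        by (simp add: eval_fps_at_0 fps_nth_nth_deriv pochhammer_fact)
      then show "fps_nth f n \<ge> 0"
        using mult_le_cancel_left_pos[of "fact n" 0 "fps_nth f n"] by simp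
    qed
  }
  {
    assume nonneg: "\<forall>n. fps_nth f n \<ge> 0"
    show "abs_monotonic_on g {0<..<1}"
      unfolding abs_monotonic_on_def
    proof (intro allI ballI conjI)
      fix k and x :: real assume "x \<in> {0<..<1}"
      then have x: "\<bar>x\<bar> < 1" "0 < x" by auto
      have "eventually (\<lambda>z. z \<in> {-1<..<1}) (nhds x)"
        using x by (intro eventually_nhds_in_open) auto
      then have ev: "eventually (\<lambda>z. (deriv ^^ k) g z = eval_fps (fps_nth_deriv k f) z) (nhds x)"
        by (rule eventually_mono) (use derivs in auto)
      have "(eval_fps (fps_nth_deriv k f) has_field_derivative
              eval_fps (fps_deriv (fps_nth_deriv k f)) x) (at x)"
        by (rule has_field_derivative_eval_fps, rule less_radius, rule x)
      then have "((deriv ^^ k) g has_field_derivative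
              eval_fps (fps_deriv (fps_nth_deriv k f)) x) (at x)"
        using DERIV_cong_ev[OF refl ev refl] by blast
      then show "(deriv ^^ k) g differentiable at x"
        using real_differentiable_def by blast
      have "eval_fps (fps_nth_deriv k f) x \<ge> 0"
        unfolding eval_fps_def
      proof (rule suminf_nonneg)
        show "summable (\<lambda>n. fps_nth (fps_nth_deriv k f) n * x ^ n)"
          by (rule summable_fps, rule less_radius, rule x)
        show "0 \<le> fps_nth (fps_nth_deriv k f) n * x ^ n" for n
          using nonneg x by (auto simp: fps_nth_nth_deriv intro!: mult_nonneg_nonneg pochhammer_nonneg)
      qed
      then show "0 \<le> (deriv ^^ k) g x" using derivs[of x k] x by simp
    qed
  }
qed

lemma abs_monotonic_on_higher_deriv_iff:
  fixes f :: "real fps"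
  assumes conv: "fps_conv_radius f \<ge> 1"
    and eq: "\<And>x. \<bar>x\<bar> < 1 \<Longrightarrow> g x = eval_fps f x"
  shows "abs_monotonic_on ((deriv ^^ k) g) {0<..<1} \<longleftrightarrow> (\<forall>n\<ge>k. fps_nth f n \<ge> 0)"
    and "abs_monotonic_on (\<lambda>x. - (deriv ^^ k) g x) {0<..<1} \<longleftrightarrow> (\<forall>n\<ge>k. fps_nth f n \<le> 0)"
proof -
  have shift: "(\<forall>n. P (n + k)) \<longleftrightarrow> (\<forall>n\<ge>k. P n)" for P :: "nat \<Rightarrow> bool"
    by (metis add.commute le_Suc_ex le_add2)
  have "pochhammer (real n + 1) k > 0" for n
    by (rule pochhammer_pos) simp
  then have pos: "pochhammer (real n + 1) k * y \<ge> 0 \<longleftrightarrow> y \<ge> 0" for n y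
    by (simp add: zero_le_mult_iff less_le_not_le)
  note conv' = conv_radius_nth_deriv[OF conv]
  note less_radius = norm_less_conv_radius[OF conv']
  show "abs_monotonic_on ((deriv ^^ k) g) {0<..<1} \<longleftrightarrow> (\<forall>n\<ge>k. fps_nth f n \<ge> 0)"
    using abs_monotonic_on_power_series_iff[OF conv' higher_deriv_power_series[OF conv eq], of k]
    by (simp add: fps_nth_nth_deriv pos shift[symmetric])
  have "abs_monotonic_on (\<lambda>x. - (deriv ^^ k) g x) {0<..<1}
      \<longleftrightarrow> (\<forall>n. fps_nth (- fps_nth_deriv k f) n \<ge> 0)"
    by (rule abs_monotonic_on_power_series_iff)
       (simp_all add: conv' higher_deriv_power_series[OF conv eq] eval_fps_minus[OF less_radius])
  then show "abs_monotonic_on (\<lambda>x. - (deriv ^^ k) g x) {0<..<1} \<longleftrightarrow> (\<forall>n\<ge>k. fps_nth f n \<le> 0)"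
    using pos[of _ "- fps_nth f _"] by (simp add: fps_nth_nth_deriv shift[symmetric])
qed


section \<open>Hypergeometric series with log-convex coefficients\<close>

definition hyp_coeff :: "real \<Rightarrow> real \<Rightarrow> real \<Rightarrow> nat \<Rightarrow> real" where
  "hyp_coeff a b c n = pochhammer a n * pochhammer b n / (pochhammer c n * fact n)"

definition hyp_fps :: "real \<Rightarrow> real \<Rightarrow> real \<Rightarrow> real fps" where
  "hyp_fps a b c = Abs_fps (hyp_coeff a b c)"

definition logderiv_fps :: "real \<Rightarrow> real \<Rightarrow> real \<Rightarrow> real fps" where
  "logderiv_fps a b c = fps_deriv (hyp_fps a b c) * inverse (hyp_fps a b c)"

text \<open>
  The expansion of \<open>ln \<F>\<^sub>p\<close>, as the integral of \<open>F'/F - p / (1 - x)\<close>.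
\<close>

definition log_fps :: "real \<Rightarrow> real \<Rightarrow> real \<Rightarrow> real \<Rightarrow> real fps" where
  "log_fps a b c p = fps_integral0 (logderiv_fps a b c - fps_const p * Abs_fps (\<lambda>_. 1))"

text \<open>
  The excess of \<open>(n + 1) A\<^sub>n\<^sub>+\<^sub>1 / A\<^sub>n = (a + n) (b + n) / (c + n)\<close> over \<open>n\<close>, written in partial
  fractions so that its monotonicity and its limit are visible.
\<close>

definition excess :: "real \<Rightarrow> real \<Rightarrow> real \<Rightarrow> nat \<Rightarrow> real" where
  "excess a b c n = (a + b - c) + (c - a) * (c - b) / (c + real n)"

lemma gauss_hyp_eq_eval_fps: "gauss_hyp a b c x = eval_fps (hyp_fps a b c) x"
  by (simp add: gauss_hyp_def eval_fps_def hyp_fps_def hyp_coeff_def)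

locale pos_hyp =
  fixes a b c :: real
  assumes a: "a > 0" and b: "b > 0" and c: "c > 0"
begin

abbreviation "A \<equiv> hyp_coeff a b c"
abbreviation "F \<equiv> hyp_fps a b c"
abbreviation "D \<equiv> logderiv_fps a b c"
abbreviation "G \<equiv> log_fps a b c"
abbreviation "\<psi> \<equiv> excess a b c"

lemma coeff_pos: "A n > 0"
  unfolding hyp_coeff_def using a b c
  by (intro divide_pos_pos mult_pos_pos pochhammer_pos) auto

lemma coeff_0 [simp]: "A 0 = 1"
  by (simp add: hyp_coeff_def)

lemma coeff_Suc: "real (Suc n) * A (Suc n) = (real n + \<psi> n) * A n"
proof -
  have cn: "c + real n > 0" using c by simp
  have "(real n + \<psi> n) * (c + real n) = (a + real n) * (b + real n)"
    using cn by (simp add: excess_def field_simps)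
  then have "real n + \<psi> n = (a + real n) * (b + real n) / (c + real n)"
    using cn by (simp add: field_simps)
  moreover have "A (Suc n) = A n * ((a + real n) * (b + real n) / (c + real n)) / real (Suc n)"
    by (simp add: hyp_coeff_def pochhammer_Suc mult_ac del: of_nat_Suc)
  ultimately show ?thesis by (simp del: of_nat_Suc)
qed

lemma excess_tendsto: "\<psi> \<longlonglongrightarrow> a + b - c"
  unfolding excess_def using c by real_asymp

lemma coeff_ratio: "A (Suc n) / A n = (real n + \<psi> n) / real (Suc n)"
  using coeff_Suc[of n] coeff_pos[of n] by (simp add: field_simps del: of_nat_Suc)

text \<open>
  The difference of consecutive ratios has the sign of
  \<open>(c + 1 - a - b) (c + n) (c + n + 1) - (c - a) (c - b) (c + 2 n + 2)\<close>.
\<close>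

lemma coeff_log_convex:
  assumes "\<And>n. (c - a) * (c - b) * (c + 2 * real n + 2)
                  \<le> (c + 1 - a - b) * ((c + real n) * (c + real n + 1))"
  shows "mono (\<lambda>n. A (Suc n) / A n)"
proof (rule incseq_SucI)
  fix n
  define u m s e where "u = c + real n" and "m = real n + 1" and "s = a + b - c"
    and "e = (c - a) * (c - b)"
  have u: "u > 0" and m: "m > 0" using c by (auto simp: u_def m_def)
  have "(m + s + e / (u + 1)) / (m + 1) - (m - 1 + s + e / u) / m
      = ((1 - s) * (u * (u + 1)) - e * (m + u + 1)) / (m * (m + 1) * (u * (u + 1)))"
    using u m by (simp add: divide_simps) (simp add: algebra_simps)
  also have "\<dots> \<ge> 0"
  proof (intro divide_nonneg_pos mult_pos_pos)
    show "(1 - s) * (u * (u + 1)) - e * (m + u + 1) \<ge> 0"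
      using assms[of n] by (simp add: u_def m_def s_def e_def algebra_simps)
  qed (use u m in auto)
  finally show "A (Suc n) / A n \<le> A (Suc (Suc n)) / A (Suc n)"
    by (simp add: coeff_ratio excess_def u_def m_def s_def e_def algebra_simps)
qed

end

locale log_convex_hyp = pos_hyp +
  assumes log_convex: "mono (\<lambda>n. hyp_coeff a b c (Suc n) / hyp_coeff a b c n)"
begin

text \<open>
  The ratios of consecutive coefficients increase to \<open>1\<close>.
\<close>

lemma coeff_decseq: "decseq A"
proof (rule decseq_SucI)
  fix n
  have "(\<lambda>n. A (Suc n) / A n) \<longlonglongrightarrow> 1"
    unfolding coeff_ratio excess_def using c by real_asymp
  then have "A (Suc n) / A n \<le> 1"
    by (rule incseq_le[OF log_convex])
  then show "A (Suc n) \<le> A n" using coeff_pos[of n] by simp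
qed

lemma coeff_le_1: "A n \<le> 1"
  using decseqD[OF coeff_decseq, of 0 n] by simp

lemma logderiv_mult: "D * F = fps_deriv F"
proof -
  have "fps_nth F 0 \<noteq> 0" by (simp add: hyp_fps_def)
  then show ?thesis
    by (simp add: logderiv_fps_def mult.assoc inverse_mult_eq_1)
qed

lemma logderiv_conv: "(\<Sum>k\<le>n. fps_nth D k * A (n - k)) = (real n + \<psi> n) * A n"
proof -
  have "(\<Sum>k\<le>n. fps_nth D k * A (n - k)) = fps_nth (D * F) n"
    by (simp add: fps_mult_nth hyp_fps_def atLeast0AtMost)
  also have "\<dots> = real (Suc n) * A (Suc n)"
    by (simp only: logderiv_mult) (simp add: hyp_fps_def)
  finally show ?thesis by (simp only: coeff_Suc)
qed

text \<open>
  By \<open>\<psi>\<^sub>k A\<^sub>k = (k + 1) A\<^sub>k\<^sub>+\<^sub>1 - k A\<^sub>k\<close> the right-hand side telescopes.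
\<close>

lemma logderiv_conv_partial_sums:
  "(\<Sum>k\<le>n. fps_nth D k * A (n - k)) = (\<Sum>k\<le>n. \<psi> k * A k)"
proof -
  have "(\<Sum>k\<le>n. \<psi> k * A k) = real (Suc n) * A (Suc n)"
  proof (induction n)
    case 0 then show ?case by (simp only: coeff_Suc) simp
  next
    case (Suc n)
    have "(\<Sum>k\<le>Suc n. \<psi> k * A k) = real (Suc n) * A (Suc n) + \<psi> (Suc n) * A (Suc n)"
      using Suc by simp
    then show ?case by (simp only: coeff_Suc[of "Suc n"]) (simp only: distrib_right)
  qed
  then show ?thesis by (simp only: logderiv_conv coeff_Suc)
qed

definition H :: "nat \<Rightarrow> real" where
  "H n = fps_nth ((1 - fps_X) * D) n"

lemma H_0: "H 0 = fps_nth D 0"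
  and H_Suc: "H (Suc n) = fps_nth D (Suc n) - fps_nth D n"
  by (simp_all add: H_def algebra_simps)

lemma H_sum: "(\<Sum>k\<le>n. H k) = fps_nth D n"
  by (induction n) (simp_all add: H_0 H_Suc)

lemma H_conv: "(\<Sum>k\<le>n. H k * A (n - k)) = \<psi> n * A n"
proof -
  have "(\<Sum>k\<le>n. H k * A (n - k)) = fps_nth ((1 - fps_X) * D * F) n"
    by (subst fps_mult_nth) (simp add: H_def hyp_fps_def atLeast0AtMost)
  also have "(1 - fps_X) * D * F = (1 - fps_X) * fps_deriv F"
    by (simp only: logderiv_mult mult.assoc)
  also have "fps_nth ((1 - fps_X) * fps_deriv F) n = real (Suc n) * A (Suc n) - real n * A n"
    by (cases n) (simp_all add: left_diff_distrib hyp_fps_def)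
  also have "\<dots> = \<psi> n * A n" by (simp only: coeff_Suc) (simp add: algebra_simps)
  finally show ?thesis .
qed

lemma logderiv_0: "fps_nth D 0 = a * b / c"
  using logderiv_conv[of 0] c by (simp add: excess_def field_simps)

text \<open>
  The right-hand side of the convolution identity is \<open>w\<^sub>n A\<^sub>n\<close> with
  \<open>w\<^sub>n = (n + 1) A\<^sub>n\<^sub>+\<^sub>1 / A\<^sub>n\<close>, a product of two increasing factors.
\<close>

lemma logderiv_nonneg: "fps_nth D n \<ge> 0"
proof (cases n)
  case 0
  then show ?thesis using logderiv_0 a b c by simp
next
  case (Suc m)
  have eq: "real n + \<psi> n = real (Suc n) * (A (Suc n) / A n)" for n
    by (simp only: coeff_ratio) simp
  have "mono (\<lambda>n. real n + \<psi> n)"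
    unfolding eq
    by (intro monoI mult_mono monoD[OF log_convex])
       (auto intro: less_imp_le[OF divide_pos_pos[OF coeff_pos coeff_pos]])
  from kaluza_sign[OF coeff_pos log_convex logderiv_conv this] Suc
  show ?thesis by simp
qed

lemma logderiv_conv_term_le:
  assumes "k \<le> n"
  shows "fps_nth D k * A (n - k) \<le> real (Suc n) * A (Suc n)"
proof -
  have "fps_nth D k * A (n - k) \<le> (\<Sum>k\<le>n. fps_nth D k * A (n - k))"
    by (rule member_le_sum) (use assms logderiv_nonneg less_imp_le[OF coeff_pos] in auto)
  then show ?thesis by (simp only: logderiv_conv coeff_Suc)
qed

text \<open>
  This crude bound makes the coefficients of \<open>ln F\<close> bounded, which is all that is needed
  for the logarithmic series to converge on \<open>(-1,1)\<close>.
\<close>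

lemma logderiv_le: "fps_nth D n \<le> real (Suc n)"
proof -
  have "fps_nth D n \<le> real (Suc n) * A (Suc n)"
    using logderiv_conv_term_le[of n n] by simp
  also have "\<dots> \<le> real (Suc n) * 1" by (intro mult_left_mono coeff_le_1) simp
  finally show ?thesis by simp
qed

lemma log_fps_Suc: "fps_nth (G p) (Suc n) = (fps_nth D n - p) / real (Suc n)"
  by (simp add: log_fps_def fps_integral_def field_simps del: of_nat_Suc)

lemma log_fps_0: "fps_nth (G p) 0 = 0"
  by (simp add: log_fps_def fps_integral_def)

lemma conv_radius_hyp: "fps_conv_radius F \<ge> 1"
  using coeff_le_1 less_imp_le[OF coeff_pos]
  by (intro bounded_coeffs_conv_radius[of _ 1]) (simp add: hyp_fps_def)

lemma conv_radius_log: "fps_conv_radius (G p) \<ge> 1"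
proof (rule bounded_coeffs_conv_radius)
  fix n
  show "\<bar>fps_nth (G p) n\<bar> \<le> 1 + \<bar>p\<bar>"
  proof (cases n)
    case (Suc m)
    have "\<bar>fps_nth D m - p\<bar> \<le> real (Suc m) + \<bar>p\<bar>"
      using logderiv_nonneg[of m] logderiv_le[of m] by linarith
    also have "\<dots> \<le> (1 + \<bar>p\<bar>) * real (Suc m)"
      by (simp add: algebra_simps)
    finally show ?thesis by (simp add: Suc log_fps_Suc pos_divide_le_eq del: of_nat_Suc)
  qed (simp add: log_fps_0)
qed

lemma deriv_log_fps: "fps_deriv (G p) = fps_deriv (G 0) - fps_const p * Abs_fps (\<lambda>_. 1)"
  and deriv_log_fps_0: "fps_deriv (G 0) = D"
  by (simp_all add: fps_eq_iff log_fps_Suc del: of_nat_Suc)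

lemma conv_radius_logderiv: "fps_conv_radius D \<ge> 1"
  using order_trans[OF conv_radius_log fps_conv_radius_deriv, of 0] by (simp add: deriv_log_fps_0)

lemma eval_deriv_log_fps:
  assumes x: "\<bar>x\<bar> < 1"
  shows "eval_fps (fps_deriv (G p)) x = eval_fps D x - p / (1 - x)"
proof -
  let ?g = "Abs_fps (\<lambda>_. 1) :: real fps"
  have g: "fps_conv_radius ?g \<ge> 1" by (rule bounded_coeffs_conv_radius[of _ 1]) simp
  have pg: "fps_conv_radius (fps_const p * ?g) \<ge> 1"
    by (rule bounded_coeffs_conv_radius[of _ "\<bar>p\<bar>"]) simp
  have "eval_fps (fps_const p * ?g) x = p * eval_fps ?g x"
    by (subst eval_fps_mult) (simp_all add: norm_less_conv_radius[OF g x] del: real_norm_def)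
  also have "eval_fps ?g x = 1 / (1 - x)"
    using x by (simp add: eval_fps_def suminf_geometric)
  finally show ?thesis
    unfolding deriv_log_fps[of p] deriv_log_fps_0
    by (subst eval_fps_diff)
       (simp_all add: norm_less_conv_radius[OF pg x]
          norm_less_conv_radius[OF conv_radius_logderiv x] del: real_norm_def)
qed

text \<open>
  The function \<open>\<F>\<^sub>p exp (- G\<^sub>p)\<close> has derivative zero on \<open>(-1,1)\<close>. Working with the exponential
  gives \<open>F > 0\<close> also for negative \<open>x\<close>, where the series of \<open>F\<close> alternates in sign.
\<close>

lemma ln_hyp_eq_eval_fps:
  assumes x: "\<bar>x\<bar> < 1"
  shows "ln (\<F> a b c p x) = eval_fps (G p) x"
proof -
  define Q where "Q y = (1 - y) powr p * eval_fps F y * exp (- eval_fps (G p) y)" for y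
  have "(Q has_field_derivative 0) (at y within {-1<..<1})" if "y \<in> {-1<..<1}" for y
  proof -
    have y: "\<bar>y\<bar> < 1" using that by auto
    have dF: "eval_fps (fps_deriv F) y = eval_fps D y * eval_fps F y"
      by (simp add: eval_fps_mult norm_less_conv_radius conv_radius_hyp conv_radius_logderiv y
               del: real_norm_def flip: logderiv_mult)
    have powr: "(1 - y) powr (p - 1) = (1 - y) powr p / (1 - y)"
      using y by (simp add: powr_diff)
    note [derivative_intros] =
      has_field_derivative_eval_fps[OF norm_less_conv_radius[OF conv_radius_hyp y]]
      has_field_derivative_eval_fps[OF norm_less_conv_radius[OF conv_radius_log y]]
    have "((\<lambda>y. (1 - y) powr p) has_field_derivative - (p * ((1 - y) powr p / (1 - y))))
            (at y within {-1<..<1})"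
      using y powr by (auto intro!: derivative_eq_intros)
    note [derivative_intros] = this
    show ?thesis
      unfolding Q_def
      by (rule derivative_eq_intros refl)+
         (simp add: dF eval_deriv_log_fps[OF y] algebra_simps)
  qed
  then obtain k where k: "\<And>y. y \<in> {-1<..<1} \<Longrightarrow> Q y = k"
    using has_field_derivative_zero_constant[of "{-1<..<1}" Q] by auto
  have "x \<in> {-1<..<1}" using x by auto
  then have "Q x = Q 0" using k[of x] k[of 0] by simp
  also have "Q 0 = 1"
    by (simp add: Q_def eval_fps_at_0 log_fps_0 hyp_fps_def)
  finally have "\<F> a b c p x = exp (eval_fps (G p) x)"
    by (simp add: Q_def \<F>_def gauss_hyp_eq_eval_fps exp_minus field_simps)
  then show ?thesis by simp
qed

lemma log_hyp_coeff:
  assumes "k \<ge> 1"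
  shows "real k * log_hyp_coeff a b c k = fps_nth D (k - 1)"
proof -
  obtain n where n: "k = Suc n" using assms by (cases k) auto
  have "(\<lambda>x. ln (gauss_hyp a b c x)) has_fps_expansion G 0"
    unfolding has_fps_expansion_def
  proof
    show "fps_conv_radius (G 0) > 0"
      using conv_radius_log[of 0] by (rule less_le_trans[rotated]) simp
    have "eventually (\<lambda>x::real. x \<in> {-1<..<1}) (nhds 0)"
      by (intro eventually_nhds_in_open) auto
    then show "eventually (\<lambda>x. eval_fps (G 0) x = ln (gauss_hyp a b c x)) (nhds 0)"
    proof (rule eventually_mono)
      fix x :: real assume "x \<in> {-1<..<1}"
      then show "eval_fps (G 0) x = ln (gauss_hyp a b c x)"
        using ln_hyp_eq_eval_fps[of x 0] by (auto simp: \<F>_def)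
    qed
  qed
  then show ?thesis
    by (simp add: n log_hyp_coeff_def maclaurin_coeff_eq_fps_nth log_fps_Suc del: of_nat_Suc)
qed

text \<open>
  With natural subtraction, \<open>k - 1\<close> is \<open>0\<close> for \<open>k = 0\<close> too: the constant coefficient of
  \<open>ln \<F>\<^sub>p\<close> is zero and imposes no condition.
\<close>

lemma abs_monotonic_iff:
  shows "abs_monotonic_on ((deriv ^^ k) (\<lambda>x. ln (\<F> a b c p x))) {0<..<1}
           \<longleftrightarrow> (\<forall>n\<ge>k - 1. p \<le> fps_nth D n)"
    and "abs_monotonic_on (\<lambda>x. - (deriv ^^ k) (\<lambda>x. ln (\<F> a b c p x)) x) {0<..<1}
           \<longleftrightarrow> (\<forall>n\<ge>k - 1. fps_nth D n \<le> p)"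
proof -
  have all: "(\<forall>n\<ge>k. P n) \<longleftrightarrow> (\<forall>n\<ge>k - 1. P (Suc n))" if "P 0" for P :: "nat \<Rightarrow> bool"
  proof (intro iffI allI impI)
    fix n assume *: "\<forall>n\<ge>k - 1. P (Suc n)" "n \<ge> k"
    then show "P n" using that by (cases n) auto
  qed (auto simp: le_diff_conv)
  note iff = abs_monotonic_on_higher_deriv_iff
    [OF conv_radius_log[of p], of "\<lambda>x. ln (\<F> a b c p x)" k, OF ln_hyp_eq_eval_fps]
  show "abs_monotonic_on ((deriv ^^ k) (\<lambda>x. ln (\<F> a b c p x))) {0<..<1}
           \<longleftrightarrow> (\<forall>n\<ge>k - 1. p \<le> fps_nth D n)"
    by (subst iff(1), assumption, subst all)
       (simp_all add: log_fps_0 log_fps_Suc zero_le_divide_iff del: of_nat_Suc)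
  show "abs_monotonic_on (\<lambda>x. - (deriv ^^ k) (\<lambda>x. ln (\<F> a b c p x)) x) {0<..<1}
           \<longleftrightarrow> (\<forall>n\<ge>k - 1. fps_nth D n \<le> p)"
    by (subst iff(2), assumption, subst all)
       (simp_all add: log_fps_0 log_fps_Suc divide_le_0_iff del: of_nat_Suc)
qed

text \<open>
  The term \<open>k = n\<close> of the convolution identity gives \<open>(n + 1) A\<^sub>n\<^sub>+\<^sub>1 \<ge> d\<^sub>n\<close>, so the coefficients
  dominate a multiple of the harmonic series.
\<close>

lemma not_summable_coeff:
  assumes "t > 0" and ge: "\<And>n. fps_nth D n \<ge> t"
  shows "\<not> summable A"
proof
  assume "summable A"
  then have "summable (\<lambda>n. A (Suc n))" by (simp add: summable_Suc_iff)
  then have "summable (\<lambda>n. inverse t * A (Suc n))" by (rule summable_mult)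
  moreover have "norm (inverse (real (Suc n))) \<le> inverse t * A (Suc n)" for n
  proof -
    have "t * 1 \<le> fps_nth D n * A 0" using ge[of n] by simp
    also have "\<dots> \<le> real (Suc n) * A (Suc n)"
      using logderiv_conv_term_le[of n n] by simp
    finally show ?thesis using \<open>t > 0\<close> by (simp add: field_simps)
  qed
  ultimately have "summable (\<lambda>n. inverse (real (Suc n)))"
    by (rule summable_comparison_test'[where N = 0])
  then show False
    using not_summable_harmonic summable_Suc_iff[of "\<lambda>n. inverse (real n)"] by metis
qed

text \<open>
  From \<open>d\<^sub>k \<ge> t\<close> follows \<open>\<Sum>\<^sub>k \<psi>\<^sub>k A\<^sub>k = \<Sum>\<^sub>k d\<^sub>k A\<^sub>n\<^sub>-\<^sub>k \<ge> t \<Sum>\<^sub>k A\<^sub>k\<close>: the weighted averages of \<open>\<psi>\<close>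
  are at least \<open>t\<close>.
\<close>

lemma le_excess_limit:
  assumes "t > 0" and ge: "\<And>n. fps_nth D n \<ge> t"
  shows "t \<le> a + b - c"
proof (rule weighted_average_limit_le)
  show "0 \<le> A n" for n using coeff_pos[of n] by simp
  show "\<not> summable A" by (rule not_summable_coeff) fact+
  show "\<psi> \<longlonglongrightarrow> a + b - c" by (rule excess_tendsto)
  show "(\<Sum>k\<le>n. (\<psi> k - t) * A k) \<ge> 0" for n
  proof -
    have "(\<Sum>k\<le>n. t * A k) = (\<Sum>k\<le>n. t * A (n - k))"
      by (rule sum.nat_diff_reindex[symmetric, of _ "Suc n", unfolded lessThan_Suc_atMost, simplified])
    also have "\<dots> \<le> (\<Sum>k\<le>n. fps_nth D k * A (n - k))"
      by (intro sum_mono mult_right_mono ge less_imp_le[OF coeff_pos])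
    finally show ?thesis
      by (simp add: logderiv_conv_partial_sums sum_subtractf left_diff_distrib)
  qed
qed

text \<open>
  The same comparison with the inequality reversed. The positive lower bound on \<open>d\<close> makes
  the sum of the weights diverge.
\<close>

lemma excess_limit_le:
  assumes "s > 0" "\<And>n. fps_nth D n \<ge> s" and le: "\<And>n. fps_nth D n \<le> t"
  shows "a + b - c \<le> t"
proof -
  have "- t \<le> - (a + b - c)"
  proof (rule weighted_average_limit_le)
    show "0 \<le> A n" for n using coeff_pos[of n] by simp
    show "\<not> summable A" by (rule not_summable_coeff[of s]) fact+
    show "(\<lambda>n. - \<psi> n) \<longlonglongrightarrow> - (a + b - c)" by (rule tendsto_minus[OF excess_tendsto])
    show "(\<Sum>k\<le>n. (- \<psi> k - - t) * A k) \<ge> 0" for n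
    proof -
      have "(\<Sum>k\<le>n. fps_nth D k * A (n - k)) \<le> (\<Sum>k\<le>n. t * A (n - k))"
        by (intro sum_mono mult_right_mono le less_imp_le[OF coeff_pos])
      also have "\<dots> = (\<Sum>k\<le>n. t * A k)"
        by (rule sum.nat_diff_reindex[of _ "Suc n", unfolded lessThan_Suc_atMost, simplified])
      finally show ?thesis
        by (simp add: logderiv_conv_partial_sums sum_subtractf left_diff_distrib sum_negf)
    qed
  qed
  then show ?thesis by simp
qed

lemma excess_mono:
  assumes "(c - a) * (c - b) \<le> 0"
  shows "mono \<psi>"
proof (rule incseq_SucI)
  fix n
  have "(c - a) * (c - b) / (c + real n) \<le> (c - a) * (c - b) / (c + real (Suc n))"
    using assms c by (intro divide_left_mono_neg mult_pos_pos) auto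
  then show "\<psi> n \<le> \<psi> (Suc n)" by (simp add: excess_def)
qed

lemma excess_antimono:
  assumes "(c - a) * (c - b) \<ge> 0"
  shows "mono (\<lambda>n. - \<psi> n)"
proof (rule incseq_SucI)
  fix n
  have "(c - a) * (c - b) / (c + real (Suc n)) \<le> (c - a) * (c - b) / (c + real n)"
    using assms c by (intro divide_left_mono mult_pos_pos) auto
  then show "- \<psi> n \<le> - \<psi> (Suc n)" by (simp add: excess_def)
qed

lemma logderiv_antimono:
  assumes "(c - a) * (c - b) \<ge> 0"
  shows "decseq (fps_nth D)" and "fps_nth D n \<ge> max 0 (a + b - c)"
proof -
  have conv: "(\<Sum>k\<le>n. - H k * A (n - k)) = - \<psi> n * A n" for n
    using H_conv[of n] by (simp add: sum_negf)
  have neg: "- H n \<ge> 0" if "n \<ge> 1" for n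
    by (rule kaluza_sign[OF coeff_pos log_convex conv excess_antimono[OF assms] that])
  show "decseq (fps_nth D)"
  proof (rule decseq_SucI)
    show "fps_nth D (Suc n) \<le> fps_nth D n" for n using neg[of "Suc n"] by (simp add: H_Suc)
  qed
  have "(\<Sum>k\<le>n. - H k) \<le> - \<psi> n"
    by (rule convolution_ge_partial_sum[OF coeff_pos coeff_decseq conv neg])
  then have "\<psi> n \<le> fps_nth D n" by (simp add: sum_negf H_sum)
  moreover have "a + b - c \<le> \<psi> n" using assms c by (simp add: excess_def)
  ultimately show "fps_nth D n \<ge> max 0 (a + b - c)" using logderiv_nonneg[of n] by simp
qed

lemma logderiv_mono:
  assumes "(c - a) * (c - b) \<le> 0"
  shows "incseq (fps_nth D)" and "fps_nth D n \<le> a + b - c"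
proof -
  have nonneg: "H n \<ge> 0" if "n \<ge> 1" for n
    by (rule kaluza_sign[OF coeff_pos log_convex H_conv excess_mono[OF assms] that])
  show "incseq (fps_nth D)"
  proof (rule incseq_SucI)
    show "fps_nth D n \<le> fps_nth D (Suc n)" for n using nonneg[of "Suc n"] by (simp add: H_Suc)
  qed
  have "(\<Sum>k\<le>n. H k) \<le> \<psi> n"
    by (rule convolution_ge_partial_sum[OF coeff_pos coeff_decseq H_conv nonneg])
  then have "fps_nth D n \<le> \<psi> n" by (simp add: H_sum)
  moreover have "\<psi> n \<le> a + b - c"
    using assms c by (simp add: excess_def divide_nonpos_pos)
  ultimately show "fps_nth D n \<le> a + b - c" by simp
qed

lemma abs_monotonic_iff_decreasing:
  assumes "(c - a) * (c - b) \<ge> 0"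
  shows "abs_monotonic_on ((deriv ^^ k) (\<lambda>x. ln (\<F> a b c p x))) {0<..<1}
           \<longleftrightarrow> p \<le> max 0 (a + b - c)"
    and "abs_monotonic_on (\<lambda>x. - (deriv ^^ k) (\<lambda>x. ln (\<F> a b c p x)) x) {0<..<1}
           \<longleftrightarrow> p \<ge> fps_nth D (k - 1)"
proof -
  note antimono = logderiv_antimono[OF assms]
  have "p \<le> max 0 (a + b - c)" if *: "\<forall>n\<ge>k - 1. p \<le> fps_nth D n"
  proof (cases "p > 0")
    case True
    have "p \<le> fps_nth D n" for n
      using * decseqD[OF antimono(1), of n "max n (k - 1)"]
      by (meson max.cobounded1 max.cobounded2 order_trans)
    with True le_excess_limit[of p] show ?thesis by simp
  qed simp
  then show "abs_monotonic_on ((deriv ^^ k) (\<lambda>x. ln (\<F> a b c p x))) {0<..<1}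
           \<longleftrightarrow> p \<le> max 0 (a + b - c)"
    unfolding abs_monotonic_iff using antimono(2) order_trans by blast
  show "abs_monotonic_on (\<lambda>x. - (deriv ^^ k) (\<lambda>x. ln (\<F> a b c p x)) x) {0<..<1}
           \<longleftrightarrow> p \<ge> fps_nth D (k - 1)"
    unfolding abs_monotonic_iff using decseqD[OF antimono(1)] order_trans by blast
qed

lemma abs_monotonic_iff_increasing:
  assumes "(c - a) * (c - b) \<le> 0"
  shows "abs_monotonic_on ((deriv ^^ k) (\<lambda>x. ln (\<F> a b c p x))) {0<..<1}
           \<longleftrightarrow> p \<le> fps_nth D (k - 1)"
    and "abs_monotonic_on (\<lambda>x. - (deriv ^^ k) (\<lambda>x. ln (\<F> a b c p x)) x) {0<..<1}
           \<longleftrightarrow> p \<ge> a + b - c"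
proof -
  note mono = logderiv_mono[OF assms]
  show "abs_monotonic_on ((deriv ^^ k) (\<lambda>x. ln (\<F> a b c p x))) {0<..<1}
           \<longleftrightarrow> p \<le> fps_nth D (k - 1)"
    unfolding abs_monotonic_iff using incseqD[OF mono(1)] order_trans by blast
  have "a + b - c \<le> p" if *: "\<forall>n\<ge>k - 1. fps_nth D n \<le> p"
  proof (rule excess_limit_le)
    show "a * b / c > 0" using a b c by simp
    show "a * b / c \<le> fps_nth D n" for n
      using incseqD[OF mono(1), of 0 n] by (simp add: logderiv_0)
    show "fps_nth D n \<le> p" for n
      using * incseqD[OF mono(1), of n "max n (k - 1)"]
      by (meson max.cobounded1 max.cobounded2 order_trans)
  qed
  then show "abs_monotonic_on (\<lambda>x. - (deriv ^^ k) (\<lambda>x. ln (\<F> a b c p x)) x) {0<..<1}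
           \<longleftrightarrow> p \<ge> a + b - c"
    unfolding abs_monotonic_iff using mono(2) order_trans by blast
qed

end

section \<open>The two parameter regions\<close>

text \<open>
  The polynomial condition of \<open>\<RR>\<^sub>1\<close> says exactly that the first ratio of consecutive coefficients
  is at most the second. The later ratios follow, because
  \<open>(c + 2 n + 2) / ((c + n) (c + n + 1))\<close> is largest at \<open>n = 0\<close>.
\<close>

lemma log_convex_hyp_R1:
  assumes "(a, b, c) \<in> \<RR>\<^sub>1"
  shows "log_convex_hyp a b c" and "(c - a) * (c - b) \<ge> 0"
proof -
  from assms have pos: "a > 0" "b > 0" "c > 0"
    and first: "(1 + a + b - a * b) * c \<ge> 2 * a * b" and sign: "(c - a) * (c - b) \<ge> 0"
    by (auto simp: \<RR>\<^sub>1_def)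
  show "(c - a) * (c - b) \<ge> 0" by (rule sign)
  interpret pos_hyp a b c by unfold_locales (fact pos)+
  define t e where "t = c + 1 - a - b" and "e = (c - a) * (c - b)"
  have e: "e \<ge> 0" using sign by (simp add: e_def)
  have base: "e * (c + 2) \<le> t * (c * (c + 1))"
    using first by (simp add: t_def e_def algebra_simps)
  show "log_convex_hyp a b c"
  proof (unfold_locales, rule coeff_log_convex)
    fix n
    define x where "x = real n"
    have x: "x \<ge> 0" by (simp add: x_def)
    have "c * (c + 1) * (c + 2 * x + 2) \<le> (c + 2) * ((c + x) * (c + x + 1))"
    proof -
      have "(c + 2) * ((c + x) * (c + x + 1)) - c * (c + 1) * (c + 2 * x + 2)
          = 2 * x * c + (x * x + x) * (c + 2)"
        by (simp add: algebra_simps)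
      also have "\<dots> \<ge> 0" using x pos by simp
      finally show ?thesis by simp
    qed
    then have "e * (c * (c + 1) * (c + 2 * x + 2)) \<le> e * ((c + 2) * ((c + x) * (c + x + 1)))"
      using e by (rule mult_left_mono)
    also have "\<dots> = (e * (c + 2)) * ((c + x) * (c + x + 1))" by simp
    also have "\<dots> \<le> (t * (c * (c + 1))) * ((c + x) * (c + x + 1))"
      using base x pos by (intro mult_right_mono) auto
    finally have "(c * (c + 1)) * (e * (c + 2 * x + 2))
        \<le> (c * (c + 1)) * (t * ((c + x) * (c + x + 1)))"
      by (simp only: mult_ac)
    then have "e * (c + 2 * x + 2) \<le> t * ((c + x) * (c + x + 1))"
      by (rule mult_left_le_imp_le) (use pos in simp)
    then show "(c - a) * (c - b) * (c + 2 * real n + 2)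
        \<le> (c + 1 - a - b) * ((c + real n) * (c + real n + 1))"
      by (simp only: t_def e_def x_def)
  qed
qed

lemma log_convex_hyp_R2:
  assumes "(a, b, c) \<in> \<RR>\<^sub>2"
  shows "log_convex_hyp a b c" and "(c - a) * (c - b) \<le> 0"
proof -
  from assms have pos: "a > 0" "b > 0" "c > 0" and s: "c \<ge> a + b - 1"
    and sign: "(c - a) * (c - b) \<le> 0"
    by (auto simp: \<RR>\<^sub>2_def)
  show "(c - a) * (c - b) \<le> 0" by (rule sign)
  interpret pos_hyp a b c by unfold_locales (fact pos)+
  show "log_convex_hyp a b c"
  proof (unfold_locales, rule coeff_log_convex)
    fix n
    have "(c - a) * (c - b) * (c + 2 * real n + 2) \<le> 0"
      by (rule mult_nonpos_nonneg[OF sign]) (use pos in simp)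
    also have "0 \<le> (c + 1 - a - b) * ((c + real n) * (c + real n + 1))"
      using s pos by simp
    finally show "(c - a) * (c - b) * (c + 2 * real n + 2)
        \<le> (c + 1 - a - b) * ((c + real n) * (c + real n + 1))" .
  qed
qed

theorem theorem5:
  fixes a b c p :: real
  shows "((a, b, c) \<in> \<RR>\<^sub>1 \<longrightarrow>
      (abs_monotonic_on (\<lambda>x. ln (\<F> a b c p x)) {0<..<1} \<longleftrightarrow> p \<le> max 0 (a + b - c)) \<and>
      (abs_monotonic_on (\<lambda>x. - ln (\<F> a b c p x)) {0<..<1} \<longleftrightarrow> p \<ge> a * b / c) \<and>
      (\<forall>k\<ge>1.
        (abs_monotonic_on ((deriv ^^ k) (\<lambda>x. ln (\<F> a b c p x))) {0<..<1}
          \<longleftrightarrow> p \<le> max 0 (a + b - c)) \<and>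
        (abs_monotonic_on (\<lambda>x. - (deriv ^^ k) (\<lambda>x. ln (\<F> a b c p x)) x) {0<..<1}
          \<longleftrightarrow> p \<ge> real k * log_hyp_coeff a b c k)))
    \<and> ((a, b, c) \<in> \<RR>\<^sub>2 \<longrightarrow>
      (abs_monotonic_on (\<lambda>x. ln (\<F> a b c p x)) {0<..<1} \<longleftrightarrow> p \<le> a * b / c) \<and>
      (abs_monotonic_on (\<lambda>x. - ln (\<F> a b c p x)) {0<..<1} \<longleftrightarrow> p \<ge> a + b - c) \<and>
      (\<forall>k\<ge>1.
        (abs_monotonic_on ((deriv ^^ k) (\<lambda>x. ln (\<F> a b c p x))) {0<..<1}
          \<longleftrightarrow> p \<le> real k * log_hyp_coeff a b c k) \<and>
        (abs_monotonic_on (\<lambda>x. - (deriv ^^ k) (\<lambda>x. ln (\<F> a b c p x)) x) {0<..<1}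
          \<longleftrightarrow> p \<ge> a + b - c)))"
proof (intro conjI impI)
  assume R: "(a, b, c) \<in> \<RR>\<^sub>1"
  interpret log_convex_hyp a b c by (rule log_convex_hyp_R1[OF R])
  note iff = abs_monotonic_iff_decreasing[OF log_convex_hyp_R1(2)[OF R], of _ p]
  show "abs_monotonic_on (\<lambda>x. ln (\<F> a b c p x)) {0<..<1} \<longleftrightarrow> p \<le> max 0 (a + b - c)"
    using iff(1)[of 0] by simp
  show "abs_monotonic_on (\<lambda>x. - ln (\<F> a b c p x)) {0<..<1} \<longleftrightarrow> p \<ge> a * b / c"
    using iff(2)[of 0] by (simp add: logderiv_0)
  show "\<forall>k\<ge>1.
        (abs_monotonic_on ((deriv ^^ k) (\<lambda>x. ln (\<F> a b c p x))) {0<..<1}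
          \<longleftrightarrow> p \<le> max 0 (a + b - c)) \<and>
        (abs_monotonic_on (\<lambda>x. - (deriv ^^ k) (\<lambda>x. ln (\<F> a b c p x)) x) {0<..<1}
          \<longleftrightarrow> p \<ge> real k * log_hyp_coeff a b c k)"
    using iff log_hyp_coeff by simp
next
  assume R: "(a, b, c) \<in> \<RR>\<^sub>2"
  interpret log_convex_hyp a b c by (rule log_convex_hyp_R2[OF R])
  note iff = abs_monotonic_iff_increasing[OF log_convex_hyp_R2(2)[OF R], of _ p]
  show "abs_monotonic_on (\<lambda>x. ln (\<F> a b c p x)) {0<..<1} \<longleftrightarrow> p \<le> a * b / c"
    using iff(1)[of 0] by (simp add: logderiv_0)
  show "abs_monotonic_on (\<lambda>x. - ln (\<F> a b c p x)) {0<..<1} \<longleftrightarrow> p \<ge> a + b - c"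
    using iff(2)[of 0] by simp
  show "\<forall>k\<ge>1.
        (abs_monotonic_on ((deriv ^^ k) (\<lambda>x. ln (\<F> a b c p x))) {0<..<1}
          \<longleftrightarrow> p \<le> real k * log_hyp_coeff a b c k) \<and>
        (abs_monotonic_on (\<lambda>x. - (deriv ^^ k) (\<lambda>x. ln (\<F> a b c p x)) x) {0<..<1}
          \<longleftrightarrow> p \<ge> a + b - c)"
    using iff log_hyp_coeff by simp
qed

end
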